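(* Let $(u_n)_{n\ge0}$, $(v_n)_{n\ge0}$ be the sequences defined in the context, and for $r\in\mathbb{R}$, $m,M\in\mathbb{Z}_{\ge0}$ let $C_M^{(r,m)}$ be the quantities defined in the context. Then for all $r\in\mathbb{R}$ and $m,M\in\mathbb{Z}_{\ge0}$, $$C^{(r,m)}_{2M}=\sum_{\substack{0\le k,p\le2M\\0\le n\le M\\0\le\beta\le2M-2n}}\Bigg(\frac{\binom{-n+r}{k}\binom{2n+m}{p}\binom{2M-2n}{\beta}\,k!\,p!}{4^n\,n!\,(2M-2n)!}\,u_0^{-n+r-k}\,v_0^{2n+m-p}\,B_{\beta,k}(u_1,\dots,u_{\beta-k+1})\,B_{2M-2n-\beta,\,p}(v_1,\dots,v_{2M-2n-\beta-p+1})\Bigg),$$ where $B_{\beta,k}$ are the (partial) Bell polynomials.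
   Context: Let $a(t)>0$ be smooth, $A(t)=1/a(t)$, $B(t)=A(t)^2$, and for a (Brownian bridge) path $\alpha$ on $[0,1]$ set $x_n(\alpha)=\int_0^1\alpha(v)^ndv$, $u_n=B^{(n)}(t)2^{n/2}x_n(\alpha)$, $v_n=A^{(n+1)}(t)2^{n/2}x_n(\alpha)$. Define $$C^{(r,m)}_M=\sum \frac{\binom{-n+r}{k}\binom{2n+m}{p}}{4^n\,n!}\,u_0^{-n+r-k}v_0^{2n+m-p}\,\frac{u_{\ell_1}\cdots u_{\ell_k}v_{q_1}\cdots v_{q_p}}{\ell_1!\cdots\ell_k!\,q_1!\cdots q_p!},$$ summed over integers $0\le k,p,N\le M$, $0\le n\le M/2$ with $N+2n=M$, and integers $1\le\ell_1,\dots,\ell_k,q_1,\dots,q_p\le N$ with $\ell_1+\cdots+\ell_k+q_1+\cdots+q_p=N$ (empty products are $1$; $\binom{x}{k}$ is the generalized binomial coefficient; terms with vanishing binomial coefficient are zero). Bell polynomials: $B_{\beta,k}(x_1,\dots,x_{\beta-k+1})=\sum_\lambda\frac{\beta!}{\lambda_1!\lambda_2!\cdots}\prod_i\left(\frac{x_i}{i!}\right)^{\lambda_i}$, summed over sequences $\lambda=(\lambda_1,\lambda_2,\dots)$ of non-negative integers with $\sum_ii\lambda_i=\beta$, $\sum_i\lambda_i=k$. Conventions: $B_{0,0}=1$, $B_{\beta,0}=0$ for $\beta>0$, $B_{\beta,k}=0$ for $0\le\beta<k$. *)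

theory Defs
  imports "HOL-Analysis.Analysis"
begin

definition smooth_on :: "(real \<Rightarrow> real) \<Rightarrow> real set \<Rightarrow> bool" where
  "smooth_on f I \<longleftrightarrow> (\<forall>n. \<forall>s\<in>I. (deriv ^^ n) f differentiable (at s))"

(* The Brownian bridge measure is carried by the continuous paths from 0 to 0;
   here a single such path is fixed. *)
definition bridge_path :: "(real \<Rightarrow> real) \<Rightarrow> bool" where
  "bridge_path \<alpha> \<longleftrightarrow> continuous_on {0..1} \<alpha> \<and> \<alpha> 0 = 0 \<and> \<alpha> 1 = 0"

definition path_moment :: "(real \<Rightarrow> real) \<Rightarrow> nat \<Rightarrow> real" where
  "path_moment \<alpha> n = integral {0..1} (\<lambda>v. \<alpha> v ^ n)"

definition A_fun :: "(real \<Rightarrow> real) \<Rightarrow> real \<Rightarrow> real" where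
  "A_fun a s = 1 / a s"

definition B_fun :: "(real \<Rightarrow> real) \<Rightarrow> real \<Rightarrow> real" where
  "B_fun a s = (A_fun a s)\<^sup>2"

definition u_seq :: "(real \<Rightarrow> real) \<Rightarrow> (real \<Rightarrow> real) \<Rightarrow> real \<Rightarrow> nat \<Rightarrow> real" where
  "u_seq a \<alpha> t n = (deriv ^^ n) (B_fun a) t * 2 powr (real n / 2) * path_moment \<alpha> n"

definition v_seq :: "(real \<Rightarrow> real) \<Rightarrow> (real \<Rightarrow> real) \<Rightarrow> real \<Rightarrow> nat \<Rightarrow> real" where
  "v_seq a \<alpha> t n = (deriv ^^ (n + 1)) (A_fun a) t * 2 powr (real n / 2) * path_moment \<alpha> n"

(* The tuples l and q are indexed from 1. The exponent of u 0 is real, and u 0 > 0 for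
   u = u_seq; the exponent of v 0 is an integer, negative only if the binomial coefficient
   in front vanishes (v 0 may be zero or negative). *)
definition C_coeff :: "(nat \<Rightarrow> real) \<Rightarrow> (nat \<Rightarrow> real) \<Rightarrow> real \<Rightarrow> nat \<Rightarrow> nat \<Rightarrow> real" where
  "C_coeff u v r m M =
    (\<Sum>k\<le>M. \<Sum>p\<le>M. \<Sum>N\<le>M. \<Sum>n | 2 * n \<le> M \<and> N + 2 * n = M.
      \<Sum>(l, q) | l \<in> {1..k} \<rightarrow>\<^sub>E {1..N} \<and> q \<in> {1..p} \<rightarrow>\<^sub>E {1..N} \<and>
               (\<Sum>i=1..k. l i) + (\<Sum>j=1..p. q j) = N.
        ((- real n + r) gchoose k) * (real (2 * n + m) gchoose p) / (4 ^ n * fact n)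
        * u 0 powr (- real n + r - real k) * v 0 powi (int (2 * n + m) - int p)
        * (((\<Prod>i=1..k. u (l i)) * (\<Prod>j=1..p. v (q j)))
           / ((\<Prod>i=1..k. fact (l i)) * (\<Prod>j=1..p. fact (q j)))))"

(* Index set of the partial Bell polynomial: finitely supported sequences
   lam 1, lam 2, ...; the unused entry lam 0 is fixed to 0. *)
definition bell_index :: "nat \<Rightarrow> nat \<Rightarrow> (nat \<Rightarrow> nat) set" where
  "bell_index \<beta> k = {lam. finite {i. lam i \<noteq> 0} \<and> lam 0 = 0 \<and>
     (\<Sum>i | lam i \<noteq> 0. i * lam i) = \<beta> \<and> (\<Sum>i | lam i \<noteq> 0. lam i) = k}"

(* Only x 1, ..., x (\<beta> - k + 1) contribute, so the whole sequence is passed as argument. *)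
definition bell_poly :: "nat \<Rightarrow> nat \<Rightarrow> (nat \<Rightarrow> real) \<Rightarrow> real" where
  "bell_poly \<beta> k x = (\<Sum>lam\<in>bell_index \<beta> k.
     fact \<beta> / (\<Prod>i | lam i \<noteq> 0. fact (lam i))
     * (\<Prod>i | lam i \<noteq> 0. (x i / fact i) ^ lam i))"

lemma bell_index_finite: "finite (bell_index \<beta> k)"
proof -
  have "bell_index \<beta> k \<subseteq> {f. \<forall>i. (i \<in> {..\<beta>} \<longrightarrow> f i \<in> {..k}) \<and> (i \<notin> {..\<beta>} \<longrightarrow> f i = 0)}"
  proof
    fix lam assume L: "lam \<in> bell_index \<beta> k"
    let ?S = "{i. lam i \<noteq> 0}"
    have fin: "finite ?S" and b: "(\<Sum>i\<in>?S. i * lam i) = \<beta>" and k: "(\<Sum>i\<in>?S. lam i) = k"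
      using L by (auto simp: bell_index_def)
    have "lam i \<le> k" for i
      using member_le_sum[OF _ _ fin, of i lam] k by (cases "lam i = 0") auto
    moreover have "i \<le> \<beta>" if "lam i \<noteq> 0" for i
    proof -
      have "i * lam i \<le> \<beta>"
        using member_le_sum[OF _ _ fin, of i "\<lambda>i. i * lam i"] b that by auto
      moreover have "i * 1 \<le> i * lam i" using that by (intro mult_le_mono) auto
      ultimately show ?thesis by linarith
    qed
    ultimately show "lam \<in> {f. \<forall>i. (i \<in> {..\<beta>} \<longrightarrow> f i \<in> {..k}) \<and> (i \<notin> {..\<beta>} \<longrightarrow> f i = 0)}"
      by force
  qed
  moreover have "finite {f. \<forall>i. (i \<in> {..\<beta>} \<longrightarrow> f i \<in> {..k}) \<and> (i \<notin> {..\<beta>} \<longrightarrow> f i = 0)}"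
    by (rule finite_set_of_finite_funs) auto
  ultimately show ?thesis by (rule finite_subset)
qed

lemma bell_poly_0_0: "bell_poly 0 0 x = 1"
proof -
  have "bell_index 0 0 = {\<lambda>_. 0}"
    by (auto simp: bell_index_def fun_eq_iff)
  then show ?thesis by (simp add: bell_poly_def)
qed

lemma bell_poly_0_right: "\<beta> > 0 \<Longrightarrow> bell_poly \<beta> 0 x = 0"
proof -
  assume "\<beta> > 0"
  then have "bell_index \<beta> 0 = {}"
    by (auto simp: bell_index_def)
  then show ?thesis by (simp add: bell_poly_def)
qed

lemma bell_poly_less: "\<beta> < k \<Longrightarrow> bell_poly \<beta> k x = 0"
proof -
  assume less: "\<beta> < k"
  have "k \<le> \<beta>" if "lam \<in> bell_index \<beta> k" for lam
  proof -
    have "(\<Sum>i | lam i \<noteq> 0. lam i) \<le> (\<Sum>i | lam i \<noteq> 0. i * lam i)"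
    proof (rule sum_mono)
      fix i assume "i \<in> {i. lam i \<noteq> 0}"
      then have "i \<noteq> 0" using that by (metis (mono_tags, lifting) bell_index_def mem_Collect_eq)
      then show "lam i \<le> i * lam i" by simp
    qed
    then show ?thesis using that by (simp add: bell_index_def)
  qed
  then have "bell_index \<beta> k = {}" using less by fastforce
  then show ?thesis by (simp add: bell_poly_def)
qed

end

(* Expanding (y 1 X + ... + y N X^N)^k with y i = x i / i! shows that the sum of the products of
   y over k-tuples of total b is a coefficient of a k-th power, so it satisfies a convolution recursion in k.
   Deleting one unit from a sequence lam shows that (k! / b!) B_{b,k} satisfies the same recursion,
   whence the two agree. The proposition follows by splitting the pairs of tuples (l, q)
   according to the total of l. *)
theory Submission
  imports Defs "HOL-Computational_Algebra.Polynomial"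
begin

text \<open>A nonzero entry at i contributes at least i to the weighted sum \<open>b\<close>, so the
  support lies in \<open>{1..n}\<close> for every \<open>n\<close> at least \<open>b\<close>.
  Leaving \<open>n\<close> free lets index sets with totals \<open>b\<close> and
  \<open>b - i\<close> be described over one common range.\<close>

lemma bell_index_iff:
  assumes "b \<le> n"
  shows "lam \<in> bell_index b k \<longleftrightarrow> (\<forall>i. i \<notin> {1..n} \<longrightarrow> lam i = 0) \<and>
    (\<Sum>i=1..n. i * lam i) = b \<and> (\<Sum>i=1..n. lam i) = k" (is "_ \<longleftrightarrow> ?R")
proof
  assume L: "lam \<in> bell_index b k"
  then have fin: "finite {i. lam i \<noteq> 0}" and zero: "lam 0 = 0"
    and b: "(\<Sum>i | lam i \<noteq> 0. i * lam i) = b" and k: "(\<Sum>i | lam i \<noteq> 0. lam i) = k"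
    by (auto simp: bell_index_def)
  have sub: "{i. lam i \<noteq> 0} \<subseteq> {1..n}"
  proof
    fix i assume i: "i \<in> {i. lam i \<noteq> 0}"
    then have "i * lam i \<le> b"
      using member_le_sum[OF i, of "\<lambda>i. i * lam i"] b fin by auto
    moreover have "i * 1 \<le> i * lam i" using i by (intro mult_le_mono) auto
    moreover have "i \<noteq> 0" using i zero by (cases i) auto
    ultimately show "i \<in> {1..n}" using assms unfolding atLeastAtMost_iff by linarith
  qed
  have "(\<Sum>i=1..n. i * lam i) = b"
    unfolding b[symmetric] by (rule sum.mono_neutral_right) (use sub in auto)
  moreover have "(\<Sum>i=1..n. lam i) = k"
    unfolding k[symmetric] by (rule sum.mono_neutral_right) (use sub in auto)
  ultimately show ?R using sub by blast
next
  assume R: ?R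
  then have sub: "{i. lam i \<noteq> 0} \<subseteq> {1..n}" by fastforce
  have "(\<Sum>i=1..n. i * lam i) = (\<Sum>i | lam i \<noteq> 0. i * lam i)"
    by (rule sum.mono_neutral_right) (use sub in auto)
  moreover have "(\<Sum>i=1..n. lam i) = (\<Sum>i | lam i \<noteq> 0. lam i)"
    by (rule sum.mono_neutral_right) (use sub in auto)
  ultimately show "lam \<in> bell_index b k"
    using R finite_subset[OF sub] by (auto simp: bell_index_def)
qed

text \<open>Factors outside the support equal 1, so the product may run over a fixed range instead
  of the support, which can change when an entry is lowered.\<close>

lemma bell_poly_eq:
  assumes "b \<le> n"
  shows "bell_poly b k x =
    fact b * (\<Sum>lam\<in>bell_index b k. \<Prod>i=1..n. (x i / fact i) ^ lam i / fact (lam i))"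
  unfolding bell_poly_def sum_distrib_left
proof (rule sum.cong[OF refl])
  fix lam assume "lam \<in> bell_index b k"
  then have "\<forall>i. i \<notin> {1..n} \<longrightarrow> lam i = 0"
    unfolding bell_index_iff[OF assms] by (rule conjunct1)
  then have sub: "{i. lam i \<noteq> 0} \<subseteq> {1..n}"
    by fastforce
  have "fact b / (\<Prod>i | lam i \<noteq> 0. fact (lam i)) * (\<Prod>i | lam i \<noteq> 0. (x i / fact i) ^ lam i)
      = fact b * (\<Prod>i | lam i \<noteq> 0. (x i / fact i) ^ lam i / fact (lam i))"
    by (simp add: prod_dividef)
  also have "(\<Prod>i | lam i \<noteq> 0. (x i / fact i) ^ lam i / fact (lam i)) =
      (\<Prod>i=1..n. (x i / fact i) ^ lam i / fact (lam i))"
    by (rule prod.mono_neutral_left) (use sub in auto)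
  finally show "fact b / (\<Prod>i | lam i \<noteq> 0. fact (lam i)) * (\<Prod>i | lam i \<noteq> 0. (x i / fact i) ^ lam i)
      = fact b * (\<Prod>i=1..n. (x i / fact i) ^ lam i / fact (lam i))" .
qed

text \<open>Sequences with \<open>lam i = 0\<close> contribute nothing. On the others, lowering
  \<open>lam i\<close> by one is a bijection onto \<open>bell_index (b - i) k\<close>; the factor
  \<open>lam i\<close> cancels against \<open>fact (lam i)\<close>, and one power of
  \<open>y i\<close> comes out.\<close>

lemma sum_bell_index_mult:
  fixes y :: "nat \<Rightarrow> real"
  assumes i: "i \<in> {1..b}"
  shows "(\<Sum>lam\<in>bell_index b (Suc k). real (lam i) * (\<Prod>j=1..b. y j ^ lam j / fact (lam j))) =
    y i * (\<Sum>mu\<in>bell_index (b - i) k. \<Prod>j=1..b. y j ^ mu j / fact (mu j))"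
proof -
  let ?w = "\<lambda>lam. \<Prod>j=1..b. y j ^ lam j / fact (lam j)"
  let ?D = "{lam \<in> bell_index b (Suc k). lam i \<noteq> 0}"
  \<comment> \<open>Isolating entry \<open>i\<close> leaves a remainder that raising or lowering
    this entry does not affect.\<close>
  have split: "(\<Sum>j=1..b. f j) = f i + (\<Sum>j\<in>{1..b} - {i}. f j)" for f :: "nat \<Rightarrow> nat"
    using i by (simp add: sum.remove)
  have raise: "mu(i := Suc (mu i)) \<in> bell_index b (Suc k) \<longleftrightarrow> mu \<in> bell_index (b - i) k" for mu
  proof -
    have "(\<Sum>j\<in>{1..b} - {i}. j * (mu(i := Suc (mu i))) j) = (\<Sum>j\<in>{1..b} - {i}. j * mu j)"
      "(\<Sum>j\<in>{1..b} - {i}. (mu(i := Suc (mu i))) j) = (\<Sum>j\<in>{1..b} - {i}. mu j)"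
      by (auto intro!: sum.cong)
    then show ?thesis
      using i unfolding bell_index_iff[OF order_refl, of _ b] bell_index_iff[OF diff_le_self] split
      by auto
  qed
  have weight: "real (Suc (mu i)) * ?w (mu(i := Suc (mu i))) = y i * ?w mu" for mu
  proof -
    have "(\<Prod>j\<in>{1..b} - {i}. y j ^ (mu(i := Suc (mu i))) j / fact ((mu(i := Suc (mu i))) j)) =
        (\<Prod>j\<in>{1..b} - {i}. y j ^ mu j / fact (mu j))"
      by (auto intro!: prod.cong)
    then show ?thesis
      using i by (simp add: prod.remove[of _ i] field_simps del: of_nat_Suc)
  qed
  have "(\<Sum>lam\<in>bell_index b (Suc k). real (lam i) * ?w lam) = (\<Sum>lam\<in>?D. real (lam i) * ?w lam)"
    by (rule sum.mono_neutral_right) (auto simp: bell_index_finite)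
  \<comment> \<open>On \<open>?D\<close> the subtraction \<open>lam i - 1\<close> is not truncated,
    so raising entry \<open>i\<close> undoes lowering it.\<close>
  also have "\<dots> = (\<Sum>mu\<in>bell_index (b - i) k. y i * ?w mu)"
  proof (rule sum.reindex_bij_witness[of _ "\<lambda>mu. mu(i := Suc (mu i))" "\<lambda>lam. lam(i := lam i - 1)"])
    fix lam assume lam: "lam \<in> ?D"
    then show eq: "(lam(i := lam i - 1))(i := Suc ((lam(i := lam i - 1)) i)) = lam"
      by auto
    show "lam(i := lam i - 1) \<in> bell_index (b - i) k"
      using lam raise[of "lam(i := lam i - 1)"] unfolding eq by blast
    show "y i * ?w (lam(i := lam i - 1)) = real (lam i) * ?w lam"
      using weight[of "lam(i := lam i - 1)"] lam unfolding eq by simp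
  next
    fix mu assume "mu \<in> bell_index (b - i) k"
    then show "mu(i := Suc (mu i)) \<in> ?D"
      using raise by simp
  qed auto
  finally show ?thesis
    by (simp add: sum_distrib_left)
qed

text \<open>In terms of set partitions, this marks one of the \<open>Suc k\<close> blocks and sorts
  by its size i; what remains is a partition of \<open>b - i\<close> elements into \<open>k\<close>
  blocks.\<close>

lemma bell_poly_Suc:
  "real (Suc k) * (bell_poly b (Suc k) x / fact b) =
    (\<Sum>i=1..b. x i / fact i * (bell_poly (b - i) k x / fact (b - i)))"
proof -
  let ?w = "\<lambda>lam. \<Prod>j=1..b. (x j / fact j) ^ lam j / fact (lam j)"
  have "real (Suc k) * (bell_poly b (Suc k) x / fact b) =
      (\<Sum>lam\<in>bell_index b (Suc k). real (Suc k) * ?w lam)"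
    by (simp add: bell_poly_eq[OF order_refl] flip: sum_distrib_left del: of_nat_Suc)
  \<comment> \<open>The entries of \<open>lam\<close> add up to \<open>Suc k\<close>, which
    distributes this factor over the positions i.\<close>
  also have "\<dots> = (\<Sum>lam\<in>bell_index b (Suc k). (\<Sum>i=1..b. real (lam i)) * ?w lam)"
  proof (rule sum.cong[OF refl])
    fix lam assume "lam \<in> bell_index b (Suc k)"
    then have "real (Suc k) = (\<Sum>i=1..b. real (lam i))"
      using bell_index_iff[of b b] by (metis of_nat_sum order_refl)
    then show "real (Suc k) * ?w lam = (\<Sum>i=1..b. real (lam i)) * ?w lam"
      by (simp only:)
  qed
  also have "\<dots> = (\<Sum>i=1..b. \<Sum>lam\<in>bell_index b (Suc k). real (lam i) * ?w lam)"
    unfolding sum_distrib_right by (rule sum.swap)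
  also have "\<dots> = (\<Sum>i=1..b. x i / fact i * (\<Sum>mu\<in>bell_index (b - i) k. ?w mu))"
    by (intro sum.cong[OF refl] sum_bell_index_mult)
  also have "\<dots> = (\<Sum>i=1..b. x i / fact i * (bell_poly (b - i) k x / fact (b - i)))"
    by (intro sum.cong[OF refl]) (simp add: bell_poly_eq[of _ b])
  finally show ?thesis .
qed

lemma prod_monom:
  "(\<Prod>i\<in>S. monom (f i) (g i)) = monom (\<Prod>i\<in>S. f i :: 'a::comm_semiring_1) (\<Sum>i\<in>S. g i)"
  by (induction S rule: infinite_finite_induct) (auto simp: mult_monom)

text \<open>Expanding the power picks the monomial of degree \<open>l i\<close> from the i-th
  factor, so the tuple \<open>l\<close> contributes exactly to the degree that is its total.\<close>

lemma sum_tuples_eq_coeff: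
  fixes y :: "nat \<Rightarrow> 'a::comm_semiring_1"
  shows "(\<Sum>l | l \<in> {1..k} \<rightarrow>\<^sub>E {1..N} \<and> (\<Sum>i=1..k. l i) = b. \<Prod>i=1..k. y (l i)) =
    coeff ((\<Sum>j=1..N. monom (y j) j) ^ k) b"
proof -
  have "(\<Sum>j=1..N. monom (y j) j) ^ k = (\<Prod>i=1..k. \<Sum>j=1..N. monom (y j) j)"
    by simp
  also have "\<dots> = (\<Sum>l\<in>{1..k} \<rightarrow>\<^sub>E {1..N}. \<Prod>i=1..k. monom (y (l i)) (l i))"
    by (rule prod_sum_PiE) auto
  finally have "coeff ((\<Sum>j=1..N. monom (y j) j) ^ k) b =
      (\<Sum>l\<in>{1..k} \<rightarrow>\<^sub>E {1..N}. if (\<Sum>i=1..k. l i) = b then \<Prod>i=1..k. y (l i) else 0)"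
    by (simp add: prod_monom coeff_sum del: One_nat_def)
  then show ?thesis
    by (simp add: sum.inter_filter finite_PiE del: One_nat_def)
qed

text \<open>Induction on \<open>k\<close>: one more factor convolves the coefficients, just as in
  \<open>bell_poly_Suc\<close>. The bound on \<open>b\<close> ensures that cutting the series off at
  degree \<open>N\<close> loses no term that reaches degree \<open>b\<close>.\<close>

lemma coeff_power_eq_bell_poly:
  assumes "b \<le> N"
  shows "coeff ((\<Sum>j=1..N. monom (x j / fact j) j) ^ k) b = fact k * bell_poly b k x / fact b"
  using assms
proof (induction k arbitrary: b)
  \<comment> \<open>The power is the constant 1, which matches the values of
    \<open>bell_poly b 0 x\<close> for \<open>b = 0\<close> and \<open>b > 0\<close>.\<close>
  case 0
  then show ?case
    by (cases b) (simp_all add: bell_poly_0_0 bell_poly_0_right)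
next
  case (Suc k)
  let ?F = "\<Sum>j=1..N. monom (x j / fact j) j"
  have F: "coeff ?F i = (if i \<in> {1..N} then x i / fact i else 0)" for i
    by (simp add: coeff_sum del: One_nat_def)
  have "coeff (?F ^ Suc k) b = (\<Sum>i\<le>b. coeff ?F i * coeff (?F ^ k) (b - i))"
    by (simp add: coeff_mult)
  \<comment> \<open>\<open>?F\<close> has no constant term, so the convolution starts at 1, as the
    recursion does.\<close>
  also have "\<dots> = (\<Sum>i=1..b. coeff ?F i * coeff (?F ^ k) (b - i))"
    by (rule sum.mono_neutral_right) (auto simp: F simp del: One_nat_def)
  also have "\<dots> = (\<Sum>i=1..b. fact k * (x i / fact i * (bell_poly (b - i) k x / fact (b - i))))"
  proof (rule sum.cong[OF refl])
    fix i assume "i \<in> {1..b}"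
    then show "coeff ?F i * coeff (?F ^ k) (b - i) =
        fact k * (x i / fact i * (bell_poly (b - i) k x / fact (b - i)))"
      using Suc.prems by (simp add: F Suc.IH del: One_nat_def)
  qed
  also have "\<dots> = fact k * (real (Suc k) * (bell_poly b (Suc k) x / fact b))"
    by (simp only: bell_poly_Suc sum_distrib_left)
  finally show ?case
    by (simp add: mult_ac)
qed

lemma sum_tuples_eq_bell_poly:
  assumes "b \<le> N"
  shows "(\<Sum>l | l \<in> {1..k} \<rightarrow>\<^sub>E {1..N} \<and> (\<Sum>i=1..k. l i) = b. \<Prod>i=1..k. x (l i) / fact (l i)) =
    fact k * bell_poly b k x / fact b"
  using sum_tuples_eq_coeff[where y = "\<lambda>j. x j / fact j" and k = k and N = N and b = b] coeff_power_eq_bell_poly[OF assms]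
  by simp

text \<open>Once \<open>l\<close> has total \<beta>, the total of \<open>q\<close> must be
  \<open>N - \<beta>\<close>, so the sum factors for each \<beta>. Both totals are at most
  \<open>N\<close>, hence each factor is a Bell polynomial, and the two denominators combine to
  \<open>(N choose \<beta>) / fact N\<close>.\<close>

lemma sum_tuple_pairs_eq_bell_poly:
  "(\<Sum>(l, q) | l \<in> {1..k} \<rightarrow>\<^sub>E {1..N} \<and> q \<in> {1..p} \<rightarrow>\<^sub>E {1..N} \<and>
        (\<Sum>i=1..k. l i) + (\<Sum>j=1..p. q j) = N.
      (\<Prod>i=1..k. u (l i) / fact (l i)) * (\<Prod>j=1..p. v (q j) / fact (q j))) =
    (\<Sum>\<beta>\<le>N. real (N choose \<beta>) * fact k * fact p / fact N * bell_poly \<beta> k u * bell_poly (N - \<beta>) p v)"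
proof -
  define L where "L b = {l \<in> {1..k} \<rightarrow>\<^sub>E {1..N}. (\<Sum>i=1..k. l i) = b}" for b
  define Q where "Q b = {q \<in> {1..p} \<rightarrow>\<^sub>E {1..N}. (\<Sum>j=1..p. q j) = b}" for b
  let ?f = "\<lambda>l. \<Prod>i=1..k. u (l i) / fact (l i)"
  let ?g = "\<lambda>q. \<Prod>j=1..p. v (q j) / fact (q j)"
  have finL: "finite (L b)" for b
    unfolding L_def by (rule finite_subset[of _ "{1..k} \<rightarrow>\<^sub>E {1..N}"]) (auto intro: finite_PiE)
  have finQ: "finite (Q b)" for b
    unfolding Q_def by (rule finite_subset[of _ "{1..p} \<rightarrow>\<^sub>E {1..N}"]) (auto intro: finite_PiE)
  have "{(l, q). l \<in> {1..k} \<rightarrow>\<^sub>E {1..N} \<and> q \<in> {1..p} \<rightarrow>\<^sub>E {1..N} \<and>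
      (\<Sum>i=1..k. l i) + (\<Sum>j=1..p. q j) = N} = (\<Union>\<beta>\<in>{..N}. L \<beta> \<times> Q (N - \<beta>))"
    by (fastforce simp: L_def Q_def)
  then have "(\<Sum>(l, q) | l \<in> {1..k} \<rightarrow>\<^sub>E {1..N} \<and> q \<in> {1..p} \<rightarrow>\<^sub>E {1..N} \<and>
        (\<Sum>i=1..k. l i) + (\<Sum>j=1..p. q j) = N. ?f l * ?g q) =
      (\<Sum>(l, q)\<in>(\<Union>\<beta>\<in>{..N}. L \<beta> \<times> Q (N - \<beta>)). ?f l * ?g q)"
    by simp
  \<comment> \<open>The products are disjoint for different \<beta>, since \<beta> is the total of
    \<open>l\<close>.\<close>
  also have "\<dots> = (\<Sum>\<beta>\<le>N. \<Sum>(l, q)\<in>L \<beta> \<times> Q (N - \<beta>). ?f l * ?g q)"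
    by (rule sum.UNION_disjoint) (auto simp: finL finQ, auto simp: L_def)
  also have "\<dots> = (\<Sum>\<beta>\<le>N. sum ?f (L \<beta>) * sum ?g (Q (N - \<beta>)))"
    by (simp add: sum_product sum.cartesian_product)
  also have "\<dots> = (\<Sum>\<beta>\<le>N. real (N choose \<beta>) * fact k * fact p / fact N
      * bell_poly \<beta> k u * bell_poly (N - \<beta>) p v)"
  proof (rule sum.cong[OF refl])
    fix \<beta> assume "\<beta> \<in> {..N}"
    then have "\<beta> \<le> N" by simp
    then show "sum ?f (L \<beta>) * sum ?g (Q (N - \<beta>)) = real (N choose \<beta>) * fact k * fact p / fact N
        * bell_poly \<beta> k u * bell_poly (N - \<beta>) p v"
      unfolding L_def Q_def sum_tuples_eq_bell_poly[OF \<open>\<beta> \<le> N\<close>]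
        sum_tuples_eq_bell_poly[OF diff_le_self]
      by (simp add: binomial_fact field_simps)
  qed
  finally show ?thesis .
qed

lemma C_coeff_even_eq_bell_poly:
  "C_coeff u v r m (2 * M) =
    (\<Sum>k\<le>2 * M. \<Sum>p\<le>2 * M. \<Sum>n\<le>M. \<Sum>\<beta>\<le>2 * M - 2 * n.
      ((- real n + r) gchoose k) * (real (2 * n + m) gchoose p)
      * real ((2 * M - 2 * n) choose \<beta>) * fact k * fact p
      / (4 ^ n * fact n * fact (2 * M - 2 * n))
      * u 0 powr (- real n + r - real k)
      * v 0 powi (int (2 * n + m) - int p)
      * bell_poly \<beta> k u
      * bell_poly (2 * M - 2 * n - \<beta>) p v)"
proof -
  \<comment> \<open>\<open>c\<close> collects the factors that do not depend on the tuples;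
    \<open>T\<close> is the value of the sum over pairs of tuples.\<close>
  define c where "c k p n = ((- real n + r) gchoose k) * (real (2 * n + m) gchoose p) / (4 ^ n * fact n)
        * u 0 powr (- real n + r - real k) * v 0 powi (int (2 * n + m) - int p)" for k p n
  define T where "T k p N = (\<Sum>\<beta>\<le>N. real (N choose \<beta>) * fact k * fact p / fact N
        * bell_poly \<beta> k u * bell_poly (N - \<beta>) p v)" for k p N
  \<comment> \<open>The constraint determines \<open>N\<close> as \<open>2 * M - 2 * n\<close>, and
    every \<open>n\<close> up to \<open>M\<close> occurs, so only the sum over \<open>n\<close>
    survives.\<close>
  have collapse: "(\<Sum>N\<le>2 * M. \<Sum>n | 2 * n \<le> 2 * M \<and> N + 2 * n = 2 * M. h N n) =
      (\<Sum>n\<le>M. h (2 * M - 2 * n) n)" for h :: "nat \<Rightarrow> nat \<Rightarrow> real"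
  proof -
    have fin: "finite {n. 2 * n \<le> 2 * M \<and> N + 2 * n = 2 * M}" for N
      by (rule finite_subset[of _ "{..M}"]) auto
    have "(\<Sum>N\<le>2 * M. \<Sum>n | 2 * n \<le> 2 * M \<and> N + 2 * n = 2 * M. h N n) =
        (\<Sum>(N, n)\<in>(SIGMA N:{..2 * M}. {n. 2 * n \<le> 2 * M \<and> N + 2 * n = 2 * M}). h N n)"
      by (rule sum.Sigma) (use fin in auto)
    also have "\<dots> = (\<Sum>n\<le>M. h (2 * M - 2 * n) n)"
      by (rule sum.reindex_bij_witness[of _ "\<lambda>n. (2 * M - 2 * n, n)" snd])
        (auto, metis add_diff_cancel_right')
    finally show ?thesis .
  qed
  have "C_coeff u v r m (2 * M) = (\<Sum>k\<le>2 * M. \<Sum>p\<le>2 * M. \<Sum>N\<le>2 * M.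
      \<Sum>n | 2 * n \<le> 2 * M \<and> N + 2 * n = 2 * M. c k p n * T k p N)"
    unfolding C_coeff_def c_def T_def sum_tuple_pairs_eq_bell_poly[symmetric]
    by (simp add: sum_distrib_left prod_dividef case_prod_unfold mult.assoc)
  also have "\<dots> = (\<Sum>k\<le>2 * M. \<Sum>p\<le>2 * M. \<Sum>n\<le>M. c k p n * T k p (2 * M - 2 * n))"
    by (simp only: collapse)
  finally show ?thesis
    by (simp add: c_def T_def sum_distrib_left mult_ac)
qed

theorem proposition3p3:
  fixes a \<alpha> :: "real \<Rightarrow> real" and I :: "real set" and t r :: real and m M :: nat
  assumes "open I" and "t \<in> I"
    and "smooth_on a I" and "\<And>s. s \<in> I \<Longrightarrow> a s > 0"
    and "bridge_path \<alpha>"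
  shows "C_coeff (u_seq a \<alpha> t) (v_seq a \<alpha> t) r m (2 * M) =
    (\<Sum>k\<le>2 * M. \<Sum>p\<le>2 * M. \<Sum>n\<le>M. \<Sum>\<beta>\<le>2 * M - 2 * n.
      ((- real n + r) gchoose k) * (real (2 * n + m) gchoose p)
      * real ((2 * M - 2 * n) choose \<beta>) * fact k * fact p
      / (4 ^ n * fact n * fact (2 * M - 2 * n))
      * u_seq a \<alpha> t 0 powr (- real n + r - real k)
      * v_seq a \<alpha> t 0 powi (int (2 * n + m) - int p)
      * bell_poly \<beta> k (u_seq a \<alpha> t)
      * bell_poly (2 * M - 2 * n - \<beta>) p (v_seq a \<alpha> t))"
  by (rule C_coeff_even_eq_bell_poly)

end
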